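(* Consider the following algorithm for sorting under partial information with partial information $P$ of order $n$: compute a greedy chain decomposition $C_1,\dots,C_k$ of $P$; let $\mathcal C=\{C_1,\dots,C_k\}$; while $|\mathcal C|>1$, pick two chains $C,C'$ of smallest cardinality in $\mathcal C$ (ties broken arbitrarily), merge them into a chain $C''$ by the standard linear merge, and replace $C,C'$ by $C''$ in $\mathcal C$. Then for every $\varepsilon>0$ and every unknown linear order consistent with $P$, the number of comparisons performed is at most $$(1+\varepsilon)\log e(P) + (1+\varepsilon)\Big(\log e + \log\Big(1+\frac1\varepsilon\Big)\Big)\,n + n .$$
   Context: Sorting under partial information: $V$ is a set of $n$ elements carrying an unknown linear order $\leqslant$; a poset $P=(V,\leqslant_P)$ whose relations are all relations of $\leqslant$ is given; the algorithm must determine $\leqslant$ using queries ``is $v\leqslant w$?'' (comparisons). $e(P)$ is the number of linear extensions of $P$, $\log$ is the binary logarithm and $e$ in $\log e$ is Euler's number. A greedy chain decomposition of $P$ is a partition of $V$ into chains $C_1,\dots,C_k$ where $C_1$ is a chain of maximum cardinality of $P$ and, for $i\ge2$, $C_i$ is a chain of maximum cardinality of the subposet induced on $V-C_1-\cdots-C_{i-1}$, until no element remains. The standard linear merge of two disjoint chains repeatedly compares the smallest remaining elements of both chains and outputs the smaller; once one chain is exhausted the rest of the other is appended without comparisons. *)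

theory Defs
  imports Complex_Main
begin

definition linear_extensions :: "'a set \<Rightarrow> 'a rel \<Rightarrow> 'a rel set" where
  "linear_extensions V P = {L. linear_order_on V L \<and> P \<subseteq> L}"

definition max_chain :: "'a set \<Rightarrow> 'a rel \<Rightarrow> 'a set \<Rightarrow> bool" where
  "max_chain U P C \<longleftrightarrow>
     C \<in> Chains (Restr P U) \<and> (\<forall>D \<in> Chains (Restr P U). card D \<le> card C)"

fun greedy_chain_decomposition :: "'a set \<Rightarrow> 'a rel \<Rightarrow> 'a set list \<Rightarrow> bool" where
  "greedy_chain_decomposition U P [] \<longleftrightarrow> U = {}"
| "greedy_chain_decomposition U P (C # Cs) \<longleftrightarrow>
     U \<noteq> {} \<and> max_chain U P C \<and> greedy_chain_decomposition (U - C) P Cs"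

definition increasing_list :: "'a rel \<Rightarrow> 'a list \<Rightarrow> bool" where
  "increasing_list R xs \<longleftrightarrow> distinct xs \<and> sorted_wrt (\<lambda>x y. (x, y) \<in> R) xs"

text \<open>
  The first component of the result is the merged chain, the second the number of comparisons;
  a comparison is one query to the unknown order \<open>L\<close>.
\<close>

fun linear_merge :: "'a rel \<Rightarrow> 'a list \<Rightarrow> 'a list \<Rightarrow> 'a list \<times> nat" where
  "linear_merge L [] ys = (ys, 0)"
| "linear_merge L (x # xs) [] = (x # xs, 0)"
| "linear_merge L (x # xs) (y # ys) =
     (if (x, y) \<in> L
      then (let (zs, q) = linear_merge L xs (y # ys) in (x # zs, Suc q))
      else (let (zs, q) = linear_merge L (x # xs) ys in (y # zs, Suc q)))"

definition two_smallest :: "'a list set \<Rightarrow> 'a list \<Rightarrow> 'a list \<Rightarrow> bool" where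
  "two_smallest \<C> C C' \<longleftrightarrow> C \<in> \<C> \<and> C' \<in> \<C> \<and> C \<noteq> C' \<and>
     (\<forall>D \<in> \<C> - {C, C'}. length C \<le> length D \<and> length C' \<le> length D)"

text \<open>
  \<open>merge_run L \<C> q \<D>\<close>: some complete execution of the while loop, started with the family \<open>\<C>\<close>,
  ends with the family \<open>\<D>\<close> after exactly \<open>q\<close> comparisons. The relation is nondeterministic because
  ties between chains of equal cardinality are broken arbitrarily. Chains are represented by their
  increasing enumerations.
\<close>

inductive merge_run :: "'a rel \<Rightarrow> 'a list set \<Rightarrow> nat \<Rightarrow> 'a list set \<Rightarrow> bool" for L where
  stop: "\<not> card \<C> > 1 \<Longrightarrow> merge_run L \<C> 0 \<C>"
| step: "card \<C> > 1 \<Longrightarrow> two_smallest \<C> C C' \<Longrightarrow> linear_merge L C C' = (C'', q) \<Longrightarrow>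
         merge_run L (insert C'' (\<C> - {C, C'})) r \<D> \<Longrightarrow> merge_run L \<C> (q + r) \<D>"

definition chain_lists :: "'a rel \<Rightarrow> 'a set list \<Rightarrow> 'a list set" where
  "chain_lists P Cs = {xs. increasing_list P xs \<and> set xs \<in> set Cs}"

text \<open>
  \<open>sorting_run V P L q\<close>: some execution of the whole algorithm on the partial information \<open>P\<close>, with
  queries answered according to \<open>L\<close>, performs exactly \<open>q\<close> comparisons. Computing the greedy chain
  decomposition uses only \<open>P\<close> and hence no comparisons.
\<close>

definition sorting_run :: "'a set \<Rightarrow> 'a rel \<Rightarrow> 'a rel \<Rightarrow> nat \<Rightarrow> bool" where
  "sorting_run V P L q \<longleftrightarrow>
     (\<exists>Cs \<D>. greedy_chain_decomposition V P Cs \<and> merge_run L (chain_lists P Cs) q \<D>)"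


lemma max_chain_exists:
  assumes "finite U"
  shows "\<exists>C. max_chain U P C"
proof -
  have sub: "Chains (Restr P U) \<subseteq> Pow U" by (auto simp: Chains_def)
  have "{} \<in> Chains (Restr P U)" by (simp add: Chains_def)
  moreover have "\<forall>D. D \<in> Chains (Restr P U) \<longrightarrow> card D < Suc (card U)"
    using sub assms by (auto simp: less_Suc_eq_le intro!: card_mono)
  ultimately show ?thesis
    unfolding max_chain_def
    using ex_has_greatest_nat[of "\<lambda>D. D \<in> Chains (Restr P U)" "{}" card "Suc (card U)"] by auto
qed

lemma max_chain_nonempty:
  assumes "max_chain U P C" "refl_on U P" "U \<noteq> {}"
  shows "C \<noteq> {}"
proof
  assume "C = {}"
  obtain x where "x \<in> U" using assms by blast
  hence "{x} \<in> Chains (Restr P U)" using assms(2) by (auto simp: Chains_def refl_on_def)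
  hence "card {x} \<le> card C" using assms(1) unfolding max_chain_def by blast
  thus False using \<open>C = {}\<close> by simp
qed

lemma greedy_chain_decomposition_exists:
  assumes "finite U" "refl_on U P"
  shows "\<exists>Cs. greedy_chain_decomposition U P Cs"
  using assms
proof (induction U rule: finite_psubset_induct)
  case (psubset U)
  show ?case
  proof (cases "U = {}")
    case True
    hence "greedy_chain_decomposition U P []" by simp
    thus ?thesis ..
  next
    case False
    obtain C where C: "max_chain U P C" using max_chain_exists[OF psubset.hyps] by blast
    have "C \<noteq> {}" using max_chain_nonempty[OF C psubset.prems False] .
    moreover have "C \<subseteq> U" using C by (auto simp: max_chain_def Chains_def)
    ultimately have "U - C \<subset> U" by blast
    moreover have "refl_on (U - C) P" using psubset.prems by (auto simp: refl_on_def)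
    ultimately obtain Cs where "greedy_chain_decomposition (U - C) P Cs"
      using psubset.IH by blast
    hence "greedy_chain_decomposition U P (C # Cs)" using C False by simp
    thus ?thesis ..
  qed
qed

lemma greedy_chain_decomposition_Union:
  "greedy_chain_decomposition U P Cs \<Longrightarrow> \<Union> (set Cs) = U"
proof (induction U P Cs rule: greedy_chain_decomposition.induct)
  case (2 U P C Cs)
  hence "\<Union> (set Cs) = U - C" by simp
  moreover have "C \<subseteq> U" using 2 by (auto simp: max_chain_def Chains_def)
  ultimately show ?case by auto
qed simp

lemma two_smallest_exists:
  assumes "card \<C> > 1"
  shows "\<exists>C C'. two_smallest \<C> C C'"
proof -
  have fin: "finite \<C>" using assms card.infinite by fastforce
  have "\<C> \<noteq> {}" using assms by auto
  then obtain C where C: "C \<in> \<C>" "\<forall>D \<in> \<C>. length C \<le> length D"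
    using ex_has_least_nat[of "\<lambda>D. D \<in> \<C>" _ length] by blast
  have "\<C> - {C} \<noteq> {}" using assms C(1) fin
    by (metis card_Diff_singleton card.empty diff_is_0_eq not_le)
  then obtain C' where "C' \<in> \<C> - {C}" "\<forall>D \<in> \<C> - {C}. length C' \<le> length D"
    using ex_has_least_nat[of "\<lambda>D. D \<in> \<C> - {C}" _ length] by blast
  hence "two_smallest \<C> C C'" using C by (auto simp: two_smallest_def)
  thus ?thesis by blast
qed

lemma merge_run_exists: "finite \<C> \<Longrightarrow> \<exists>q \<D>. merge_run L \<C> q \<D>"
proof (induction "card \<C>" arbitrary: \<C> rule: less_induct)
  case less
  show ?case
  proof (cases "card \<C> > 1")
    case False
    thus ?thesis by (blast intro: merge_run.stop)
  next
    case True
    obtain C C' where T: "two_smallest \<C> C C'" using two_smallest_exists[OF True] by blast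
    obtain C'' q where M: "linear_merge L C C' = (C'', q)" by fastforce
    have "card (\<C> - {C, C'}) = card \<C> - 2"
      using T less.prems by (simp add: two_smallest_def card_Diff_subset)
    moreover have "card (insert C'' (\<C> - {C, C'})) \<le> Suc (card (\<C> - {C, C'}))"
      using less.prems by (simp add: card_insert_if)
    ultimately have "card (insert C'' (\<C> - {C, C'})) < card \<C>" using True by linarith
    then obtain r \<D> where "merge_run L (insert C'' (\<C> - {C, C'})) r \<D>"
      using less.hyps less.prems by blast
    thus ?thesis using merge_run.step[OF True T M] by blast
  qed
qed

lemma sorting_run_exists:
  assumes "finite V" "partial_order_on V P"
  shows "\<exists>q. sorting_run V P L q"
proof -
  obtain Cs where Cs: "greedy_chain_decomposition V P Cs"
    using greedy_chain_decomposition_exists assms partial_order_onD(1) by blast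
  have "chain_lists P Cs \<subseteq> {xs. set xs \<subseteq> V \<and> length xs \<le> card V}"
  proof
    fix xs assume xs: "xs \<in> chain_lists P Cs"
    hence "set xs \<subseteq> V"
      using greedy_chain_decomposition_Union[OF Cs] by (auto simp: chain_lists_def)
    moreover have "length xs = card (set xs)"
      using xs by (simp add: chain_lists_def increasing_list_def distinct_card)
    ultimately show "xs \<in> {xs. set xs \<subseteq> V \<and> length xs \<le> card V}"
      using card_mono[OF assms(1)] by auto
  qed
  hence "finite (chain_lists P Cs)"
    using finite_lists_length_le[OF assms(1)] finite_subset by blast
  thus ?thesis unfolding sorting_run_def using Cs merge_run_exists by blast
qed

end

theory Submission
  imports Defs "HOL-Analysis.Convex"
begin

text \<open>
  Let \<open>n = card V\<close> and let \<open>c v\<close> be the size of the greedy chain containing \<open>v\<close>. Merging the two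
  shortest chains first is Huffman coding, so at most \<open>\<Sum>v\<in>V. log 2 (n / c v)\<close> plus \<open>n\<close>
  comparisons are made. To bound this entropy by the number \<open>e\<close> of linear extensions, put
  \<open>d = \<epsilon> / (1 + \<epsilon>)\<close> and \<open>x v = d * n powr -d * c v powr (d - 1)\<close>. Greediness implies that the
  weights \<open>x\<close> of the elements of any chain sum to at most
  \<open>d * n powr -d * (\<Sum>j=1..n. j powr (d - 1)) \<le> 1\<close>. The box spanned by such an \<open>x\<close> lies in the chain
  polytope, whose volume is \<open>e / fact n\<close>; hence \<open>fact n * (\<Prod>v\<in>V. x v) \<le> e\<close>. Taking logarithms
  and using \<open>fact n \<ge> (n / exp 1) ^ n\<close> gives the bound.
\<close>

section \<open>Linear extensions and chain weights\<close>

text \<open>An integer point of the box with sides \<open>w\<close> either has all coordinates at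
  least 2 or has some coordinate \<open>v\<close> equal to 1; the sum is the union bound over
  \<open>v\<close>.\<close>

lemma prod_le_prod_decrement_add_sum:
  fixes w :: "'a \<Rightarrow> nat"
  assumes "finite M" "\<And>v. v \<in> M \<Longrightarrow> 1 \<le> w v"
  shows "prod w M \<le> (\<Prod>v\<in>M. w v - 1) + (\<Sum>v\<in>M. prod w (M - {v}))"
  using assms
proof (induction M rule: finite_induct)
  case (insert v M)
  let ?D = "\<Prod>u\<in>M. w u - 1" and ?S = "\<Sum>u\<in>M. prod w (M - {u})"
  have S: "(\<Sum>u\<in>M. prod w (insert v M - {u})) = w v * ?S"
    unfolding sum_distrib_left
  proof (rule sum.cong)
    fix u assume "u \<in> M"
    hence "insert v M - {u} = insert v (M - {u})" using insert.hyps by auto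
    thus "prod w (insert v M - {u}) = w v * prod w (M - {u})" using insert.hyps by simp
  qed simp
  have "w v * prod w M = (w v - 1) * prod w M + prod w M"
    using insert.prems[of v] by (cases "w v") auto
  \<comment> \<open>The induction hypothesis is applied to the first summand only; the separate
    \<open>prod w M\<close> is the term of the new element \<open>v\<close>.\<close>
  also have "\<dots> \<le> (w v - 1) * (?D + ?S) + prod w M"
    using insert by simp
  also have "\<dots> \<le> (w v - 1) * ?D + w v * ?S + prod w M"
    by (simp add: algebra_simps)
  finally show ?case using insert.hyps S by simp
qed simp

lemma finite_linear_extensions: "finite V \<Longrightarrow> finite (linear_extensions V P)"
proof -
  have "linear_extensions V P \<subseteq> Pow (V \<times> V)"
    unfolding linear_extensions_def order_on_defs by blast
  thus "finite V \<Longrightarrow> finite (linear_extensions V P)" by (simp add: finite_subset)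
qed

lemma partial_order_on_Restr:
  assumes "partial_order_on V P" "W \<subseteq> V"
  shows "partial_order_on W (Restr P W)"
proof -
  have P: "refl_on V P" "trans P" "antisym P" using assms(1) by (auto simp: order_on_defs)
  have "refl_on W (Restr P W)" using P(1) assms(2) by (auto simp: refl_on_def)
  moreover have "antisym (Restr P W)" using P(3) by (rule antisym_subset[rotated]) blast
  ultimately show ?thesis using trans_Restr[OF P(2)] by (auto simp: order_on_defs)
qed

text \<open>The least element of a linear extension is minimal in \<open>P\<close>, and removing it
  leaves an extension of the rest. For the inequality it suffices to go back: putting
  \<open>v\<close> below an extension of \<open>V - {v}\<close> is injective, and different
  \<open>v\<close> give different results.\<close>

lemma sum_card_linear_extensions_minimal_le:
  assumes "finite V" "partial_order_on V P"
    and M: "M = {v \<in> V. \<forall>u. (u, v) \<in> P \<longrightarrow> u = v}"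
  shows "(\<Sum>v\<in>M. card (linear_extensions (V - {v}) (Restr P (V - {v}))))
           \<le> card (linear_extensions V P)"
proof -
  let ?E = "\<lambda>v. linear_extensions (V - {v}) (Restr P (V - {v}))"
  let ?f = "\<lambda>v K. K \<union> {v} \<times> V"
  have P: "P \<subseteq> V \<times> V" using assms(2) by (simp add: partial_order_onD(4))
  have sub: "K \<subseteq> (V - {v}) \<times> (V - {v})" if "K \<in> ?E v" for K v
    using that by (auto simp: linear_extensions_def order_on_defs)
  have inj: "inj_on (?f v) (?E v)" for v
  proof (rule inj_onI)
    fix K K' assume K: "K \<in> ?E v" "K' \<in> ?E v" and eq: "?f v K = ?f v K'"
    have "K = ?f v K - {v} \<times> V" "K' = ?f v K' - {v} \<times> V" using sub[OF K(1)] sub[OF K(2)] by auto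
    thus "K = K'" using eq by simp
  qed
  have ext: "?f v ` ?E v \<subseteq> linear_extensions V P" if "v \<in> M" for v
  proof
    fix L assume "L \<in> ?f v ` ?E v"
    then obtain K where K: "K \<in> ?E v" "L = ?f v K" by blast
    have lin: "linear_order_on (V - {v}) K" and PK: "Restr P (V - {v}) \<subseteq> K"
      using K(1) by (auto simp: linear_extensions_def)
    have "v \<in> V" using that M by simp
    have K': "refl_on (V - {v}) K" "trans K" "antisym K" "total_on (V - {v}) K"
      using lin by (auto simp: order_on_defs)
    have "L \<subseteq> V \<times> V" using sub[OF K(1)] \<open>v \<in> V\<close> by (auto simp: K(2))
    moreover have "refl_on V L" using K'(1) by (auto simp: K(2) refl_on_def)
    moreover have "trans L"
      using sub[OF K(1)] K'(2) by (auto simp: K(2) intro!: transI dest: transD)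
    moreover have "antisym L"
      using sub[OF K(1)] K'(3) by (auto simp: K(2) intro!: antisymI dest: antisymD)
    moreover have "total_on V L" using K'(4) by (auto simp: K(2) total_on_def)
    ultimately have "linear_order_on V L" by (simp add: order_on_defs)
    moreover have "P \<subseteq> L"
      using PK P that unfolding K(2) M by blast
    ultimately show "L \<in> linear_extensions V P" by (simp add: linear_extensions_def)
  qed
  have disj: "?f v ` ?E v \<inter> ?f v' ` ?E v' = {}" if "v \<in> M" "v' \<in> M" "v \<noteq> v'" for v v'
  proof (rule ccontr)
    assume "?f v ` ?E v \<inter> ?f v' ` ?E v' \<noteq> {}"
    then obtain K K' where K: "K \<in> ?E v" "K' \<in> ?E v'" "?f v K = ?f v' K'" by auto
    \<comment> \<open>In the first order \<open>v\<close> is below everything; in the second only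
      \<open>v'\<close> itself is below \<open>v'\<close>.\<close>
    have "(v, v') \<in> ?f v K" "(v, v') \<notin> ?f v' K'" using that sub[OF K(2)] M by auto
    thus False using K(3) by simp
  qed
  have "finite M" using assms(1) M by simp
  have finE: "finite (?E v)" for v using assms(1) by (simp add: finite_linear_extensions)
  have "(\<Sum>v\<in>M. card (?E v)) = (\<Sum>v\<in>M. card (?f v ` ?E v))"
    using inj by (simp add: card_image)
  also have "\<dots> = card (\<Union>v\<in>M. ?f v ` ?E v)"
    using \<open>finite M\<close> finE disj by (intro card_UN_disjoint[symmetric]) auto
  also have "\<dots> \<le> card (linear_extensions V P)"
    using ext by (intro card_mono finite_linear_extensions assms) blast
  finally show ?thesis .
qed

lemma exists_minimal_below:
  assumes "finite V" "partial_order_on V P" "v \<in> V"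
  shows "\<exists>m\<in>V. (m, v) \<in> P \<and> (\<forall>u. (u, m) \<in> P \<longrightarrow> u = m)"
proof -
  have P: "P \<subseteq> V \<times> V" "refl_on V P" "trans P"
    using assms(2) by (auto simp: order_on_defs)
  have "finite P" using P(1) assms(1) finite_subset by blast
  hence "wf (P - Id)" using partial_order_on_well_order_on assms(2) by blast
  moreover have "v \<in> {u. (u, v) \<in> P}" using P(2) assms(3) by (simp add: refl_on_def)
  ultimately obtain m where m: "m \<in> {u. (u, v) \<in> P}"
    and "\<And>u. (u, m) \<in> P - Id \<Longrightarrow> u \<notin> {u. (u, v) \<in> P}"
    by (rule wfE_min) blast
  hence "\<forall>u. (u, m) \<in> P \<longrightarrow> u = m" using transD[OF P(3)] by blast
  thus ?thesis using m P(1) by blast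
qed

lemma exists_least_in_chain:
  assumes "finite V" "partial_order_on V P" "A \<in> Chains P" "A \<noteq> {}"
  shows "\<exists>a\<in>A. \<forall>b\<in>A. (a, b) \<in> P"
proof -
  have "P \<subseteq> V \<times> V" using assms(2) by (rule partial_order_onD(4))
  hence "finite P" using assms(1) finite_subset by blast
  hence "wf (P - Id)" using partial_order_on_well_order_on assms(2) by blast
  moreover obtain a0 where "a0 \<in> A" using assms(4) by blast
  ultimately obtain a where a: "a \<in> A" "\<And>b. (b, a) \<in> P - Id \<Longrightarrow> b \<notin> A"
    by (rule wfE_min) blast
  thus ?thesis using assms(3) by (force simp: Chains_def)
qed

text \<open>
  The discrete form of the volume bound. Lowering the weights of all minimal elements by one
  lowers the weight of every maximal chain by one; the product then drops by at most the sum, over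
  the minimal elements \<open>v\<close>, of the products over \<open>V - {v}\<close>. Both parts are bounded inductively, and
  Pascal's rule puts them together.
\<close>

lemma prod_le_card_linear_extensions_binomial:
  fixes w :: "'a \<Rightarrow> nat"
  assumes "finite V" "partial_order_on V P" "\<And>A. A \<in> Chains P \<Longrightarrow> sum w A \<le> N"
  shows "prod w V \<le> card (linear_extensions V P) * ((N + card V - 1) choose card V)"
  using assms
\<comment> \<open>The measure falls in both reductions: lowering the weights keeps \<open>V\<close>
  and decreases \<open>N\<close>, deleting a minimal element keeps \<open>N\<close> and decreases
  \<open>V\<close>.\<close>
proof (induction "card V + N" arbitrary: V P w N rule: less_induct)
  case (less V N P w)
  have P: "P \<subseteq> V \<times> V" "refl_on V P" "trans P" using less.prems(2) by (auto simp: order_on_defs)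
  let ?e = "card (linear_extensions V P)"
  show ?case
  proof (cases "V = {} \<or> (\<exists>v\<in>V. w v = 0)")
    case True
    show ?thesis
    proof (cases "V = {}")
      case True
      hence "linear_extensions V P = {{}}"
        using P(1) by (auto simp: linear_extensions_def order_on_defs)
      thus ?thesis using True by simp
    next
      case False
      hence "prod w V = 0" using True less.prems(1) by auto
      thus ?thesis by simp
    qed
  next
    case False
    hence w1: "1 \<le> w v" if "v \<in> V" for v using that by force
    define M where "M = {v \<in> V. \<forall>u. (u, v) \<in> P \<longrightarrow> u = v}"
    define w' where "w' v = (if v \<in> M then w v - 1 else w v)" for v
    have M: "M \<subseteq> V" "finite M" using less.prems(1) by (auto simp: M_def)
    obtain k where k: "card V = Suc k" using False less.prems(1) by (metis card_0_eq not0_implies_Suc)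
    obtain v0 where v0: "v0 \<in> V" using False by blast
    \<comment> \<open>A one-element chain of positive weight makes \<open>N\<close> positive, so
      that it can be lowered.\<close>
    have "sum w {v0} \<le> N" using v0 P(2) by (intro less.prems(3)) (simp add: Chains_def refl_on_def)
    then obtain N' where N': "N = Suc N'" using w1[OF v0] by (cases N) auto
    have le_w: "w' v \<le> w v" for v by (simp add: w'_def)
    have finA: "finite A" "A \<subseteq> V" if "A \<in> Chains P" for A
    proof -
      show "A \<subseteq> V" using that P(1) by (auto simp: Chains_def)
      thus "finite A" using less.prems(1) finite_subset by blast
    qed
    \<comment> \<open>\<open>A\<close> may miss \<open>M\<close>. Adding a minimal element below its
      least element gives a chain, still of weight at most \<open>N\<close>, that contains an
      element whose weight was lowered.\<close>
    have chain': "sum w' A \<le> N'" if A: "A \<in> Chains P" for A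
    proof (cases "A = {}")
      case False
      obtain a where a: "a \<in> A" "\<forall>b\<in>A. (a, b) \<in> P"
        using exists_least_in_chain[OF less.prems(1,2) A False] by blast
      obtain m where m: "m \<in> V" "(m, a) \<in> P" "\<forall>u. (u, m) \<in> P \<longrightarrow> u = m"
        using exists_minimal_below[OF less.prems(1,2)] a(1) finA(2)[OF A] by blast
      have "m \<in> M" using m by (simp add: M_def)
      hence w'm: "w' m + 1 = w m" using w1[OF m(1)] by (simp add: w'_def)
      let ?B = "insert m A"
      have "(m, b) \<in> P" if "b \<in> A" for b using that a(2) m(2) P(3) by (meson transD)
      moreover have "(m, m) \<in> P" using m(1) P(2) by (simp add: refl_on_def)
      ultimately have B: "?B \<in> Chains P" using A by (auto simp: Chains_def)
      have "sum w' A \<le> sum w' ?B" using finA[OF B] by (intro sum_mono2) auto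
      also have "\<dots> = w' m + sum w' (A - {m})" using finA[OF A] by (simp add: sum.insert_remove)
      also have "\<dots> \<le> w' m + sum w (A - {m})" by (simp add: sum_mono le_w)
      also have "\<dots> + 1 = sum w ?B" using finA[OF A] w'm by (simp add: sum.insert_remove)
      finally have "sum w' A + 1 \<le> sum w ?B" by simp
      thus ?thesis using less.prems(3)[OF B] N' by simp
    qed simp
    have "prod w' V \<le> ?e * ((N' + card V - 1) choose card V)"
      using N' by (intro less.hyps less.prems chain') auto
    hence dec: "prod w' V \<le> ?e * ((N' + k) choose Suc k)" using k by simp
    have del: "prod w (V - {v}) \<le>
        card (linear_extensions (V - {v}) (Restr P (V - {v}))) * ((N' + k) choose k)" if "v \<in> M" for v
    proof -
      have cv: "card (V - {v}) = k" using that M k by (simp add: card_Diff_singleton_if subset_iff)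
      have "prod w (V - {v}) \<le> card (linear_extensions (V - {v}) (Restr P (V - {v})))
               * ((N + card (V - {v}) - 1) choose card (V - {v}))"
      proof (rule less.hyps)
        show "card (V - {v}) + N < card V + N" using cv k by simp
        show "partial_order_on (V - {v}) (Restr P (V - {v}))"
          using partial_order_on_Restr[OF less.prems(2)] by blast
        show "sum w A \<le> N" if "A \<in> Chains (Restr P (V - {v}))" for A
          using that by (intro less.prems(3)) (auto simp: Chains_def)
      qed (use less.prems(1) in simp)
      thus ?thesis unfolding cv N' by simp
    qed
    have split: "prod f V = prod f M * prod f (V - M)" for f :: "'a \<Rightarrow> nat"
      using prod.subset_diff[OF M(1) less.prems(1)] by (simp add: mult.commute)
    have "prod w V \<le> ((\<Prod>v\<in>M. w v - 1) + (\<Sum>v\<in>M. prod w (M - {v}))) * prod w (V - M)"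
      unfolding split using M w1 by (intro mult_right_mono prod_le_prod_decrement_add_sum) auto
    also have "\<dots> = (\<Prod>v\<in>M. w v - 1) * prod w (V - M) + (\<Sum>v\<in>M. prod w (M - {v}) * prod w (V - M))"
      by (simp add: distrib_right sum_distrib_right)
    also have "(\<Prod>v\<in>M. w v - 1) * prod w (V - M) = prod w' V"
      unfolding split[of w'] by (intro arg_cong2[of _ _ _ _ "(*)"] prod.cong) (auto simp: w'_def)
    also have "(\<Sum>v\<in>M. prod w (M - {v}) * prod w (V - M)) = (\<Sum>v\<in>M. prod w (V - {v}))"
    proof (rule sum.cong)
      fix v assume "v \<in> M"
      hence "V - {v} = (M - {v}) \<union> (V - M)" using M by auto
      moreover have "prod w ((M - {v}) \<union> (V - M)) = prod w (M - {v}) * prod w (V - M)"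
        using M less.prems(1) by (intro prod.union_disjoint) auto
      ultimately show "prod w (M - {v}) * prod w (V - M) = prod w (V - {v})" by simp
    qed simp
    also have "\<dots> \<le> (\<Sum>v\<in>M. card (linear_extensions (V - {v}) (Restr P (V - {v}))) * ((N' + k) choose k))"
      by (intro sum_mono del)
    also have "\<dots> \<le> ?e * ((N' + k) choose k)"
      unfolding sum_distrib_right[symmetric]
      by (intro mult_right_mono sum_card_linear_extensions_minimal_le less.prems M_def) simp
    also note dec
    finally have "prod w V \<le> ?e * ((N' + k) choose Suc k) + ?e * ((N' + k) choose k)" by simp
    thus ?thesis using N' k by (simp add: algebra_simps)
  qed
qed

text \<open>Scale the weights by \<open>N\<close>, round down, and apply the integer bound. After
  multiplication by \<open>fact (card V)\<close> and division by \<open>N ^ card V\<close>, the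
  binomial factor is at most \<open>((N + card V) / N) ^ card V\<close>, which tends to 1 as
  \<open>N\<close> grows. This limit takes the place of a volume computation.\<close>

lemma fact_mult_prod_le_card_linear_extensions:
  fixes x :: "'a \<Rightarrow> real"
  assumes "finite V" "partial_order_on V P"
    and pos: "\<And>v. v \<in> V \<Longrightarrow> 0 \<le> x v"
    and chain: "\<And>A. A \<in> Chains P \<Longrightarrow> sum x A \<le> 1"
  shows "fact (card V) * prod x V \<le> card (linear_extensions V P)"
proof -
  let ?n = "card V" and ?e = "card (linear_extensions V P)"
  let ?w = "\<lambda>N v. nat \<lfloor>real N * x v\<rfloor>"
  have bound: "fact ?n * (\<Prod>v\<in>V. real (?w N v) / N) \<le> ?e * ((real N + ?n) / N) ^ ?n" if "N > 0" for N :: nat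
  proof -
    have "sum (?w N) A \<le> N" if A: "A \<in> Chains P" for A
    proof -
      have "A \<subseteq> V" using A partial_order_onD(4)[OF assms(2)] by (auto simp: Chains_def)
      hence "real (sum (?w N) A) \<le> (\<Sum>v\<in>A. real N * x v)"
        using pos by (auto intro!: sum_mono)
      also have "\<dots> \<le> N" using chain[OF A] by (simp add: sum_distrib_left[symmetric] mult_left_le)
      finally show ?thesis by (simp only: of_nat_le_iff)
    qed
    hence "prod (?w N) V \<le> ?e * ((N + ?n - 1) choose ?n)"
      by (intro prod_le_card_linear_extensions_binomial assms)
    hence "fact ?n * prod (?w N) V \<le> ?e * (((N + ?n - 1) choose ?n) * fact ?n)"
      by (simp add: mult.commute mult.left_commute)
    also have "\<dots> \<le> ?e * (N + ?n) ^ ?n"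
      by (intro mult_left_mono order_trans[OF binomial_fact_pow] power_mono) auto
    finally have "real (fact ?n * prod (?w N) V) \<le> real (?e * (N + ?n) ^ ?n)"
      by (simp only: of_nat_le_iff)
    hence "fact ?n * (\<Prod>v\<in>V. real (?w N v)) / real N ^ ?n \<le> ?e * (real N + ?n) ^ ?n / real N ^ ?n"
      by (intro divide_right_mono) auto
    thus ?thesis by (simp add: prod_dividef power_divide)
  qed
  have floor_lim: "(\<lambda>N. real (?w N v) / N) \<longlonglongrightarrow> x v" if "v \<in> V" for v
  proof (rule tendsto_sandwich)
    have *: "real N * x v - 1 \<le> ?w N v \<and> ?w N v \<le> real N * x v" for N
      using pos[OF that] by (simp add: of_nat_nat)
    show "\<forall>\<^sub>F N in sequentially. x v - inverse (real N) \<le> real (?w N v) / N"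
      using eventually_gt_at_top[of 0]
      by eventually_elim
         (use * in \<open>simp add: pos_le_divide_eq left_diff_distrib mult.commute[of "x v"]\<close>)
    show "\<forall>\<^sub>F N in sequentially. real (?w N v) / N \<le> x v"
      using eventually_gt_at_top[of 0]
      by eventually_elim (use * in \<open>simp add: field_simps\<close>)
    show "(\<lambda>N. x v - inverse (real N)) \<longlonglongrightarrow> x v"
      using tendsto_diff[OF tendsto_const lim_inverse_n] by simp
  qed simp
  have "(\<lambda>N. ?e * (1 + ?n * inverse (real N)) ^ ?n) \<longlonglongrightarrow> real ?e * (1 + real ?n * 0) ^ ?n"
    by (intro tendsto_intros lim_inverse_n)
  moreover have "\<forall>\<^sub>F N in sequentially.
      ?e * (1 + ?n * inverse (real N)) ^ ?n = ?e * ((real N + ?n) / N) ^ ?n"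
    using eventually_gt_at_top[of 0] by eventually_elim (simp add: field_simps)
  ultimately have upper: "(\<lambda>N. ?e * ((real N + ?n) / N) ^ ?n) \<longlonglongrightarrow> ?e"
    using Lim_transform_eventually by force
  have "(\<lambda>N. fact ?n * (\<Prod>v\<in>V. real (?w N v) / N)) \<longlonglongrightarrow> fact ?n * prod x V"
    by (intro tendsto_intros tendsto_prod floor_lim)
  thus ?thesis
    by (rule tendsto_le[OF sequentially_bot upper])
       (use eventually_gt_at_top[of 0] in \<open>eventually_elim; use bound in simp\<close>)
qed

section \<open>Sizes of greedy chains\<close>

text \<open>By concavity the power lies below its tangent at 1; for positive \<open>y\<close> this
  is Young's inequality for \<open>y\<close> and 1.\<close>

lemma powr_le_affine:
  fixes y p :: real
  assumes "0 \<le> p" "p \<le> 1" "0 \<le> y"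
  shows "y powr p \<le> 1 + p * (y - 1)"
proof (cases "y = 0")
  case False
  thus ?thesis using Youngs_inequality_0[of p "1 - p" y 1] assms by (simp add: algebra_simps)
qed (use assms in simp)

text \<open>The right-hand side is the integral of \<open>t powr (d - 1)\<close> from 0 to
  \<open>a\<close>. In the induction step concavity bounds the increment of \<open>t powr d\<close>
  from below by its slope at the right end.\<close>

lemma sum_powr_le:
  fixes d :: real
  assumes "0 < d" "d \<le> 1"
  shows "(\<Sum>j=1..a. real j powr (d - 1)) \<le> real a powr d / d"
proof (induction a)
  case (Suc a)
  let ?s = "real (Suc a)"
  have "(real a / ?s) powr d \<le> 1 + d * (real a / ?s - 1)"
    using assms by (intro powr_le_affine) auto
  also have "\<dots> = 1 - d / ?s" by (simp add: field_simps)
  finally have "real a powr d \<le> (1 - d / ?s) * ?s powr d"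
    by (simp add: powr_divide field_simps)
  also have "\<dots> = ?s powr d - d * ?s powr (d - 1)"
    by (simp add: powr_diff algebra_simps)
  finally have "real a powr d / d + ?s powr (d - 1) \<le> ?s powr d / d"
    using assms by (simp add: pos_le_divide_eq distrib_right mult.commute[of _ d] distrib_left)
  thus ?case using Suc by simp
qed simp

text \<open>
  When greedy first hits a chain \<open>A\<close> with \<open>j\<close> elements left, it removes a chain of size at least
  \<open>j\<close>; so, in order of removal, the elements of \<open>A\<close> lie in greedy chains of sizes at least
  \<open>card A, card A - 1, \<dots>, 1\<close>.
\<close>

lemma greedy_chain_sizes:
  fixes f :: "nat \<Rightarrow> real"
  assumes "greedy_chain_decomposition U P Cs" "finite U"
    and anti: "\<And>i j. 1 \<le> i \<Longrightarrow> i \<le> j \<Longrightarrow> f j \<le> f i"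
  shows "\<exists>c. (\<forall>C\<in>set Cs. \<forall>v\<in>C. c v = card C) \<and>
             (\<forall>A\<in>Chains (Restr P U). (\<Sum>v\<in>A. f (c v)) \<le> (\<Sum>j=1..card A. f j))"
  using assms(1,2)
proof (induction Cs arbitrary: U)
  case Nil
  thus ?case by (auto simp: Chains_def)
next
  case (Cons C Cs)
  hence mc: "max_chain U P C" and g: "greedy_chain_decomposition (U - C) P Cs" by auto
  obtain c where c: "\<And>D v. D \<in> set Cs \<Longrightarrow> v \<in> D \<Longrightarrow> c v = card D"
    "\<And>A. A \<in> Chains (Restr P (U - C)) \<Longrightarrow> (\<Sum>v\<in>A. f (c v)) \<le> (\<Sum>j=1..card A. f j)"
    using Cons.IH[OF g] Cons.prems(2) by auto
  define c' where "c' v = (if v \<in> C then card C else c v)" for v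
  have "c' v = card D" if "D \<in> set (C # Cs)" "v \<in> D" for D v
  proof (cases "v \<in> C")
    case True
    hence "v \<notin> \<Union> (set Cs)" using greedy_chain_decomposition_Union[OF g] by simp
    thus ?thesis using that True by (auto simp: c'_def)
  qed (use that c(1) in \<open>auto simp: c'_def\<close>)
  moreover have "(\<Sum>v\<in>A. f (c' v)) \<le> (\<Sum>j=1..card A. f j)" if A: "A \<in> Chains (Restr P U)" for A
  proof -
    have "A \<subseteq> U" using A by (auto simp: Chains_def)
    hence fin: "finite A" using Cons.prems(2) finite_subset by blast
    have cA: "card A \<le> card C" using mc A by (simp add: max_chain_def)
    have split: "card A = card (A - C) + card (A \<inter> C)"
      using fin by (metis Int_Diff_Un card_Un_disjoint Int_Diff_disjoint add.commute finite_Diff finite_Int)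
    have "A - C \<in> Chains (Restr P (U - C))" using A by (auto simp: Chains_def)
    hence rest: "(\<Sum>v\<in>A - C. f (c' v)) \<le> (\<Sum>j=1..card (A - C). f j)"
      using c(2) by (simp add: c'_def)
    \<comment> \<open>The elements of \<open>A\<close> in \<open>C\<close> are removed first and
      take the largest indices. These are at most \<open>card A\<close>, hence at most
      \<open>card C\<close>, and at least 1, so \<open>anti\<close> applies.\<close>
    have "(\<Sum>v\<in>A \<inter> C. f (c' v)) = (\<Sum>j=card (A - C) + 1..card A. f (card C))"
      using split by (simp add: c'_def)
    also have "\<dots> \<le> (\<Sum>j=card (A - C) + 1..card A. f j)"
      using cA by (intro sum_mono anti) auto
    finally have hit: "(\<Sum>v\<in>A \<inter> C. f (c' v)) \<le> (\<Sum>j=card (A - C) + 1..card A. f j)" .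
    have "(\<Sum>v\<in>A. f (c' v)) = (\<Sum>v\<in>A \<inter> C. f (c' v)) + (\<Sum>v\<in>A - C. f (c' v))"
      using fin by (rule sum.Int_Diff)
    also have "\<dots> \<le> (\<Sum>j=1..card (A - C). f j) + (\<Sum>j=card (A - C) + 1..card A. f j)"
      using hit rest by linarith
    also have "\<dots> = (\<Sum>j=1..card A. f j)"
      using split sum.ub_add_nat[of 1 "card (A - C)" f "card (A \<inter> C)"] by simp
    finally show ?thesis .
  qed
  ultimately show ?case by blast
qed

section \<open>Merging the two shortest chains\<close>

text \<open>
  The binary entropy of \<open>(a, b) / (a + b)\<close> is at least twice its smaller probability.
\<close>

lemma twice_min_le_entropy_gain:
  fixes a b :: real
  assumes "0 \<le> a" "a \<le> b"
  shows "2 * a \<le> (a + b) * log 2 (a + b) - a * log 2 a - b * log 2 b"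
proof (cases "a = 0")
  case False
  hence "0 < a" "0 < b" using assms by auto
  \<comment> \<open>The gain equals
    \<open>a * log 2 ((a + b) / a) + b * log 2 ((a + b) / b)\<close>. Each summand is at least
    \<open>a\<close>: the first since \<open>(a + b) / a\<close> is at least 2, the second by the
    tangent bound at \<open>y = 2\<close> with exponent \<open>a / b\<close>.\<close>
  have "log 2 2 \<le> log 2 ((a + b) / a)"
    using assms \<open>0 < a\<close> by (intro log_mono) (simp_all add: field_simps)
  hence A: "a \<le> a * log 2 ((a + b) / a)" using \<open>0 < a\<close> by simp
  have "2 powr (a / b) \<le> 1 + (a / b) * (2 - 1)"
    using assms \<open>0 < b\<close> by (intro powr_le_affine) auto
  also have "\<dots> = (a + b) / b" using \<open>0 < b\<close> by (simp add: field_simps)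
  finally have "a / b \<le> log 2 ((a + b) / b)"
    using \<open>0 < a\<close> \<open>0 < b\<close> by (simp add: le_log_iff)
  hence "a \<le> b * log 2 ((a + b) / b)" using \<open>0 < b\<close> by (simp add: field_simps)
  thus ?thesis using A \<open>0 < a\<close> \<open>0 < b\<close> by (simp add: log_divide algebra_simps)
qed simp

lemma linear_merge_set_length:
  "linear_merge L xs ys = (zs, q) \<Longrightarrow>
     set zs = set xs \<union> set ys \<and> length zs = length xs + length ys \<and> q \<le> length xs + length ys"
proof (induction L xs ys arbitrary: zs q rule: linear_merge.induct)
  case (3 L x xs y ys)
  show ?case
  proof (cases "(x, y) \<in> L")
    case True
    obtain us r where us: "linear_merge L xs (y # ys) = (us, r)" by (rule prod.exhaust)
    hence "zs = x # us" "q = Suc r" using "3.prems" True by simp_all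
    thus ?thesis using "3.IH"(1)[OF True us] by (simp add: insert_commute)
  next
    case False
    obtain us r where us: "linear_merge L (x # xs) ys = (us, r)" by (rule prod.exhaust)
    hence "zs = y # us" "q = Suc r" using "3.prems" False by simp_all
    thus ?thesis using "3.IH"(2)[OF False us] by (simp add: insert_commute)
  qed
qed auto

text \<open>
  Merging the two shortest chains, of lengths \<open>a \<le> b\<close>, costs at most the entropy gain plus
  \<open>b - a\<close>, and afterwards every chain has length at least \<open>b\<close>. Hence the excess terms telescope;
  \<open>m\<close> carries the lower bound on the current lengths.
\<close>

lemma merge_run_cost:
  assumes "merge_run L \<C> q \<D>" "finite \<C>" "[] \<notin> \<C>"
    and "\<And>C D. C \<in> \<C> \<Longrightarrow> D \<in> \<C> \<Longrightarrow> C \<noteq> D \<Longrightarrow> set C \<inter> set D = {}"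
    and "\<And>C. C \<in> \<C> \<Longrightarrow> m \<le> length C" and "m \<le> (\<Sum>C\<in>\<C>. length C)"
    and "W = real (\<Sum>C\<in>\<C>. length C)"
  shows "real q \<le> W * log 2 W - (\<Sum>C\<in>\<C>. real (length C) * log 2 (length C)) + W - real m"
  using assms
proof (induction arbitrary: m rule: merge_run.induct)
  case (stop \<C>)
  \<comment> \<open>With at most one chain left the logarithmic terms cancel, and the claim reduces
    to \<open>m \<le> W\<close>.\<close>
  hence "card \<C> = 0 \<or> card \<C> = 1" by linarith
  thus ?case
  proof
    assume "card \<C> = 0"
    thus ?thesis using stop by simp
  next
    assume "card \<C> = 1"
    then obtain C where "\<C> = {C}" using card_1_singletonE by blast
    thus ?thesis using stop by simp
  qed
next
  case (step \<C> C C' C'' q r \<D>)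
  let ?R = "\<C> - {C, C'}"
  let ?\<phi> = "\<lambda>C. real (length C) * log 2 (length C)"
  have mem: "C \<in> \<C>" "C' \<in> \<C>" "C \<noteq> C'"
    and small: "\<And>D. D \<in> ?R \<Longrightarrow> length C \<le> length D \<and> length C' \<le> length D"
    using step.hyps(2) by (auto simp: two_smallest_def)
  have merge: "set C'' = set C \<union> set C'" "length C'' = length C + length C'" "q \<le> length C + length C'"
    using linear_merge_set_length[OF step.hyps(3)] by auto
  have "C \<noteq> []" "C' \<noteq> []" using mem step.prems(2) by auto
  have disj: "set C'' \<inter> set D = {}" if "D \<in> ?R" for D
    using that mem step.prems(3)[of C D] step.prems(3)[of C' D] unfolding merge(1) by auto
  \<comment> \<open>The family is a set: if \<open>C''\<close> coincided with a remaining chain, the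
    insertion would lose length.\<close>
  have new: "C'' \<notin> ?R"
  proof
    assume "C'' \<in> ?R"
    from disj[OF this] have "set C'' = {}" by simp
    thus False using merge(1) \<open>C \<noteq> []\<close> by simp
  qed
  have fin: "finite ?R" using step.prems(1) by simp
  have sum_old: "sum g \<C> = g C + g C' + sum g ?R" for g :: "'a list \<Rightarrow> 'b::comm_monoid_add"
  proof -
    have "\<C> = insert C (insert C' ?R)" using mem by auto
    hence "sum g \<C> = sum g (insert C (insert C' ?R))" by simp
    also have "\<dots> = g C + g C' + sum g ?R" using fin mem(3) by (simp add: add.assoc)
    finally show ?thesis .
  qed
  have sum_new: "sum g (insert C'' ?R) = g C'' + sum g ?R" for g :: "'a list \<Rightarrow> 'b::comm_monoid_add"
    using fin new by simp
  define a b where "a = min (length C) (length C')" and "b = max (length C) (length C')"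
  have "real r \<le> W * log 2 W - sum ?\<phi> (insert C'' ?R) + W - real b"
  proof (rule step.IH)
    show "finite (insert C'' ?R)" using fin by simp
    show "[] \<notin> insert C'' ?R" using step.prems(2) merge(2) \<open>C \<noteq> []\<close> by auto
    show "set D \<inter> set E = {}" if DE: "D \<in> insert C'' ?R" "E \<in> insert C'' ?R" "D \<noteq> E" for D E
    proof -
      consider "D = C''" "E \<in> ?R" | "E = C''" "D \<in> ?R" | "D \<in> ?R" "E \<in> ?R"
        using DE by blast
      thus ?thesis
      proof cases
        case 1
        thus ?thesis using disj by blast
      next
        case 2
        thus ?thesis using disj by blast
      next
        case 3
        thus ?thesis using step.prems(3) DE(3) by simp
      qed
    qed
    show "b \<le> length D" if "D \<in> insert C'' ?R" for D
      using that small merge(2) by (auto simp: b_def)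
    show "b \<le> (\<Sum>D\<in>insert C'' ?R. length D)"
      unfolding sum_new using merge(2) by (simp add: b_def)
    show "W = real (\<Sum>D\<in>insert C'' ?R. length D)"
      unfolding sum_new step.prems(6) sum_old merge(2) by simp
  qed
  \<comment> \<open>The cost is at most \<open>a + b = 2 * a + (b - a)\<close>, and the gain covers
    \<open>2 * a\<close>. Adding the bound for \<open>r\<close>, which carries \<open>- b\<close>,
    leaves \<open>- a\<close>, and \<open>m \<le> a\<close>.\<close>
  moreover have "real q \<le> ?\<phi> C'' - ?\<phi> C - ?\<phi> C' + (real b - real a)"
  proof -
    have "?\<phi> C'' - ?\<phi> C - ?\<phi> C' =
        (real a + real b) * log 2 (real a + real b) - real a * log 2 a - real b * log 2 b"
      by (cases "length C \<le> length C'") (auto simp: merge(2) a_def b_def add.commute)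
    moreover have "2 * real a \<le> \<dots>" by (rule twice_min_le_entropy_gain) (auto simp: a_def b_def)
    moreover have "real q \<le> real a + real b" using merge(3) by (simp add: a_def b_def)
    ultimately show ?thesis by linarith
  qed
  moreover have "m \<le> a" using step.prems(4) mem by (simp add: a_def)
  ultimately show ?case unfolding sum_old[of ?\<phi>] sum_new[of ?\<phi>] by simp
qed

text \<open>Ensures that each greedy chain is represented by at most one list, so that distinct
  lists of the family are disjoint.\<close>

lemma increasing_list_unique:
  assumes "antisym P" "increasing_list P xs" "increasing_list P ys" "set xs = set ys"
  shows "xs = ys"
  using assms(2-)
proof (induction xs arbitrary: ys)
  case (Cons x xs)
  then obtain y ys' where ys: "ys = y # ys'" by (cases ys) auto
  have "x = y"
  proof (rule ccontr)
    assume "x \<noteq> y"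
    hence "x \<in> set ys'" "y \<in> set xs" using Cons.prems(3) ys by auto
    hence "(y, x) \<in> P" "(x, y) \<in> P" using Cons.prems(1,2) ys by (auto simp: increasing_list_def)
    thus False using assms(1) \<open>x \<noteq> y\<close> by (auto dest: antisymD)
  qed
  moreover have "set xs = set ys'"
    using Cons.prems \<open>x = y\<close> ys by (auto simp: increasing_list_def)
  ultimately show ?case using Cons ys by (auto simp: increasing_list_def)
qed simp

section \<open>The bound\<close>

text \<open>The quotient of \<open>n ^ n\<close> by \<open>fact n\<close> is a single term of the
  exponential series at \<open>n\<close>, whose terms are all nonnegative.\<close>

lemma pow_le_fact_mult_exp: "real n ^ n \<le> fact n * exp (real n)"
proof -
  have s: "(\<lambda>k. real n ^ k /\<^sub>R fact k) sums exp (real n)" by (rule exp_converges)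
  have "(\<Sum>k\<in>{n}. real n ^ k /\<^sub>R fact k) \<le> (\<Sum>k. real n ^ k /\<^sub>R fact k)"
    using s by (intro sum_le_suminf) (auto simp: sums_iff)
  thus ?thesis using s by (simp add: sums_iff field_simps)
qed

text \<open>The sum is \<open>card V\<close> times the entropy of the partition into greedy chains.
  The inequality is the logarithm of the weight bound for \<open>x\<close>.\<close>

lemma greedy_entropy_le:
  fixes d :: real
  assumes "finite V" "partial_order_on V P" "0 < d" "d < 1"
    and "greedy_chain_decomposition V P Cs"
  obtains c where "\<And>C v. C \<in> set Cs \<Longrightarrow> v \<in> C \<Longrightarrow> c v = card C"
    and "(1 - d) * (\<Sum>v\<in>V. log 2 (card V) - log 2 (real (c v)))
           \<le> log 2 (card (linear_extensions V P)) + card V * (log 2 (exp 1) + log 2 (1 / d))"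
proof -
  let ?n = "card V" and ?e = "card (linear_extensions V P)"
  let ?f = "\<lambda>j::nat. real j powr (d - 1)"
  obtain c where c: "\<And>C v. C \<in> set Cs \<Longrightarrow> v \<in> C \<Longrightarrow> c v = card C"
    and c_chain: "\<And>A. A \<in> Chains (Restr P V) \<Longrightarrow> (\<Sum>v\<in>A. ?f (c v)) \<le> (\<Sum>j=1..card A. ?f j)"
  proof -
    \<comment> \<open>Monotonicity starts at 1, since \<open>0 powr (d - 1)\<close> is 0.\<close>
    have "?f j \<le> ?f i" if "1 \<le> i" "i \<le> j" for i j
      using that assms(4) by (intro powr_mono2') auto
    from greedy_chain_sizes[OF assms(5,1), of ?f, OF this] obtain c
      where "\<forall>C\<in>set Cs. \<forall>v\<in>C. c v = card C"
        "\<forall>A\<in>Chains (Restr P V). (\<Sum>v\<in>A. ?f (c v)) \<le> (\<Sum>j=1..card A. ?f j)"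
      by blast
    thus thesis by (intro that[of c]) auto
  qed
  have cpos: "0 < c v" if v: "v \<in> V" for v
  proof -
    have Un: "\<Union> (set Cs) = V" by (rule greedy_chain_decomposition_Union[OF assms(5)])
    then obtain C where C: "C \<in> set Cs" "v \<in> C" using v by blast
    hence "finite C" using Un assms(1) by (metis Union_upper finite_subset)
    thus ?thesis using c[OF C] C(2) card_gt_0_iff by fastforce
  qed
  define x where "x v = d * ?n powr (- d) * ?f (c v)" for v
  have npos: "0 < real ?n" if "v \<in> V" for v using that assms(1) card_gt_0_iff by fastforce
  have xpos: "0 < x v" if "v \<in> V" for v
    using npos[OF that] cpos[OF that] assms(3) by (simp add: x_def)
  have "sum x A \<le> 1" if A: "A \<in> Chains P" for A
  proof (cases "A = {}")
    case False
    have AV: "A \<subseteq> V" using A partial_order_onD(4)[OF assms(2)] by (auto simp: Chains_def)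
    hence n: "0 < real ?n" using False npos by blast
    have "A \<in> Chains (Restr P V)" using A AV by (auto simp: Chains_def)
    hence "(\<Sum>v\<in>A. ?f (c v)) \<le> real (card A) powr d / d"
      using c_chain[of A] sum_powr_le[of d "card A"] assms(3,4) by linarith
    also have "\<dots> \<le> ?n powr d / d"
      using assms(1,3) AV by (intro divide_right_mono powr_mono2) (auto intro: card_mono)
    finally have "sum x A \<le> d * ?n powr (- d) * (?n powr d / d)"
      unfolding x_def sum_distrib_left[symmetric] using assms(3) by (intro mult_left_mono) auto
    also have "\<dots> = 1" using n assms(3) by (simp add: powr_minus field_simps)
    finally show ?thesis .
  qed simp
  hence "fact ?n * prod x V \<le> ?e"
    using xpos by (intro fact_mult_prod_le_card_linear_extensions assms) (auto intro: less_imp_le)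
  moreover have prodpos: "0 < prod x V" using xpos by (intro prod_pos) auto
  moreover have "?n ^ ?n / exp ?n \<le> (fact ?n :: real)"
    using pow_le_fact_mult_exp[of ?n] by (simp add: field_simps)
  ultimately have le: "?n ^ ?n / exp ?n * prod x V \<le> ?e"
    by (meson mult_right_mono less_imp_le order_trans)
  \<comment> \<open>For empty \<open>V\<close> the power is \<open>0 ^ 0 = 1\<close>.\<close>
  have npow: "0 < real ?n ^ ?n" by (cases "?n = 0") auto
  hence "0 < ?n ^ ?n / exp ?n * prod x V" using prodpos by (intro mult_pos_pos divide_pos_pos) auto
  with le have "log 2 (?n ^ ?n / exp ?n * prod x V) \<le> log 2 ?e"
    by (intro log_mono) auto
  also have "log 2 (?n ^ ?n / exp ?n * prod x V) = log 2 (real ?n ^ ?n) - log 2 (exp ?n) + log 2 (prod x V)"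
    using npow prodpos by (simp add: log_mult log_divide)
  also have "log 2 (real ?n ^ ?n) = ?n * log 2 ?n"
    by (cases "?n = 0") (auto simp: log_nat_power)
  also have "log 2 (exp ?n) = ?n * log 2 (exp 1)" by (simp add: log_def)
  also have "log 2 (prod x V) = (\<Sum>v\<in>V. log 2 (x v))"
    using ln_prod[OF assms(1), of x] xpos by (force simp: log_def sum_divide_distrib[symmetric])
  \<comment> \<open>The separated \<open>- log 2 ?n\<close> of each element cancels, in total, the
    term \<open>?n * log 2 ?n\<close> coming from the factorial.\<close>
  also have "\<dots> = (\<Sum>v\<in>V. (1 - d) * (log 2 ?n - log 2 (c v)) - log 2 (1 / d) - log 2 ?n)"
  proof (rule sum.cong)
    fix v assume v: "v \<in> V"
    show "log 2 (x v) = (1 - d) * (log 2 ?n - log 2 (c v)) - log 2 (1 / d) - log 2 ?n"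
      unfolding x_def using npos[OF v] cpos[OF v] assms(3)
      by (simp add: log_mult log_powr log_divide algebra_simps)
  qed simp
  also have "\<dots> = (1 - d) * (\<Sum>v\<in>V. log 2 ?n - log 2 (c v)) - ?n * log 2 (1 / d) - ?n * log 2 ?n"
    by (simp only: sum_subtractf sum_distrib_left[symmetric] sum_constant)
  finally have "(1 - d) * (\<Sum>v\<in>V. log 2 ?n - log 2 (c v))
      \<le> log 2 ?e + ?n * (log 2 (exp 1) + log 2 (1 / d))"
    by (simp add: distrib_left)
  with c show ?thesis by (rule that)
qed

text \<open>A chain of length \<open>l\<close> contributes \<open>l * log 2 l\<close>, which is the
  sum of \<open>log 2 (c v)\<close> over its elements; this turns the merging cost into the entropy
  of the decomposition.\<close>

lemma merge_run_chain_lists_cost: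
  assumes "finite V" "antisym P" "greedy_chain_decomposition V P Cs" "{} \<notin> set Cs"
    and "merge_run L (chain_lists P Cs) q \<D>"
    and c: "\<And>C v. C \<in> set Cs \<Longrightarrow> v \<in> C \<Longrightarrow> c v = card C"
  shows "real q \<le> (\<Sum>v\<in>V. log 2 (card V) - log 2 (real (c v))) + card V"
proof -
  let ?\<C> = "chain_lists P Cs" and ?n = "card V"
  have Un: "\<Union> (set Cs) = V" by (rule greedy_chain_decomposition_Union[OF assms(3)])
  have mem: "set xs \<in> set Cs" "set xs \<subseteq> V" "distinct xs" "length xs = card (set xs)" if "xs \<in> ?\<C>" for xs
    using that Un by (auto simp: chain_lists_def increasing_list_def distinct_card)
  have fin: "finite ?\<C>"
    by (rule finite_subset[OF _ finite_subset_distinct[OF assms(1)]]) (use mem in auto)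
  have eq_or_disj: "C = D \<or> C \<inter> D = {}" if "C \<in> set Cs" "D \<in> set Cs" for C D
    using assms(3) that
  proof (induction Cs arbitrary: V)
    case (Cons E Cs)
    hence g: "greedy_chain_decomposition (V - E) P Cs" by simp
    show ?case using Cons.IH[OF g] Cons.prems(2,3) greedy_chain_decomposition_Union[OF g] by auto
  qed simp
  have disj: "set C \<inter> set D = {}" if "C \<in> ?\<C>" "D \<in> ?\<C>" "C \<noteq> D" for C D
  proof -
    have "set C \<noteq> set D"
      using that increasing_list_unique[OF assms(2)] by (auto simp: chain_lists_def)
    thus ?thesis using eq_or_disj[OF mem(1)[OF that(1)] mem(1)[OF that(2)]] by blast
  qed
  \<comment> \<open>The elements that the lists cover. Passing from \<open>U\<close> to
    \<open>V\<close> at the end can only increase the bound, because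
    \<open>c v \<le> card V\<close>.\<close>
  define U where "U = (\<Union>xs\<in>?\<C>. set xs)"
  have U: "U \<subseteq> V" "finite U" using mem(2) assms(1) by (auto simp: U_def intro: finite_subset)
  have sum_U: "(\<Sum>xs\<in>?\<C>. sum g (set xs)) = sum g U" for g :: "'a \<Rightarrow> 'b::comm_monoid_add"
    unfolding U_def using fin disj by (intro sum.UNION_disjoint[symmetric]) auto
  have W: "(\<Sum>xs\<in>?\<C>. length xs) = card U"
    using sum_U[of "\<lambda>_. 1::nat"] by (simp add: mem(4))
  have cV: "1 \<le> c v \<and> c v \<le> ?n" if v: "v \<in> V" for v
  proof -
    obtain C where C: "C \<in> set Cs" "v \<in> C" using v Un by blast
    hence "C \<subseteq> V" using Un by blast
    hence "finite C" "card C \<le> ?n" using assms(1) finite_subset card_mono by blast+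
    thus ?thesis using c[OF C] C(2) by (metis One_nat_def Suc_leI card_gt_0_iff empty_iff)
  qed
  have "(\<Sum>xs\<in>?\<C>. real (length xs) * log 2 (length xs)) = (\<Sum>xs\<in>?\<C>. \<Sum>v\<in>set xs. log 2 (c v))"
  proof (rule sum.cong)
    fix xs assume xs: "xs \<in> ?\<C>"
    have "(\<Sum>v\<in>set xs. log 2 (c v)) = (\<Sum>v\<in>set xs. log 2 (length xs))"
      using c[OF mem(1)[OF xs]] mem(4)[OF xs] by (intro sum.cong) auto
    thus "real (length xs) * log 2 (length xs) = (\<Sum>v\<in>set xs. log 2 (c v))"
      by (simp add: mem(4)[OF xs])
  qed simp
  also have "\<dots> = (\<Sum>v\<in>U. log 2 (c v))" by (rule sum_U)
  finally have entropy: "(\<Sum>xs\<in>?\<C>. real (length xs) * log 2 (length xs)) = (\<Sum>v\<in>U. log 2 (c v))" .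
  have "[] \<notin> ?\<C>" using assms(4) by (auto simp: chain_lists_def)
  \<comment> \<open>With the starting value \<open>m = 0\<close>, the telescoped excess costs one
    extra \<open>card U\<close>, the source of the final summand \<open>card V\<close>.\<close>
  hence "real q \<le> real (card U) * log 2 (card U) - (\<Sum>v\<in>U. log 2 (c v)) + card U"
    using merge_run_cost[OF assms(5) fin _ disj, of 0 "card U"] unfolding W entropy by simp
  also have "\<dots> = (\<Sum>v\<in>U. log 2 (card U) - log 2 (c v)) + card U"
    by (simp add: sum_subtractf)
  also have "\<dots> \<le> (\<Sum>v\<in>U. log 2 ?n - log 2 (c v)) + ?n"
  proof (intro add_mono sum_mono diff_right_mono)
    have "card U \<le> ?n" using U assms(1) by (simp add: card_mono)
    thus "real (card U) \<le> ?n" by simp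
    fix v assume "v \<in> U"
    hence "0 < card U" using U(2) card_gt_0_iff by blast
    thus "log 2 (card U) \<le> log 2 ?n" using \<open>card U \<le> ?n\<close> by simp
  qed
  also have "\<dots> \<le> (\<Sum>v\<in>V. log 2 ?n - log 2 (c v)) + ?n"
  proof (intro add_right_mono sum_mono2 assms U)
    fix v assume "v \<in> V - U"
    hence "1 \<le> c v \<and> c v \<le> ?n" using cV by blast
    thus "0 \<le> log 2 ?n - log 2 (c v)" by simp
  qed
  finally show ?thesis .
qed

lemma greedy_chain_nonempty:
  "greedy_chain_decomposition U P Cs \<Longrightarrow> refl_on U P \<Longrightarrow> {} \<notin> set Cs"
proof (induction Cs arbitrary: U)
  case (Cons C Cs)
  hence "refl_on (U - C) P" by (simp add: refl_on_def)
  thus ?case using Cons max_chain_nonempty by auto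
qed simp

theorem theorem5p2:
  fixes V :: "'a set" and P L :: "'a rel" and \<epsilon> :: real and q :: nat
  assumes "finite V"
    and "partial_order_on V P"
    and "linear_order_on V L" and "P \<subseteq> L"
    and "\<epsilon> > 0"
    and "sorting_run V P L q"
  shows "real q \<le> (1 + \<epsilon>) * log 2 (real (card (linear_extensions V P)))
           + (1 + \<epsilon>) * (log 2 (exp 1) + log 2 (1 + 1 / \<epsilon>)) * real (card V)
           + real (card V)"
proof -
  \<comment> \<open>Chosen so that dividing the entropy bound by \<open>1 - d\<close> gives the
    factor \<open>1 + \<epsilon>\<close>, while \<open>1 / d\<close> becomes
    \<open>1 + 1 / \<epsilon>\<close>.\<close>
  define d where "d = \<epsilon> / (1 + \<epsilon>)"
  have d: "0 < d" "d < 1" "1 - d = 1 / (1 + \<epsilon>)" "1 / d = 1 + 1 / \<epsilon>"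
    using assms(5) by (auto simp: d_def field_simps)
  obtain Cs \<D> where Cs: "greedy_chain_decomposition V P Cs"
    and run: "merge_run L (chain_lists P Cs) q \<D>"
    using assms(6) by (auto simp: sorting_run_def)
  obtain c where c: "\<And>C v. C \<in> set Cs \<Longrightarrow> v \<in> C \<Longrightarrow> c v = card C"
    and bound: "(1 - d) * (\<Sum>v\<in>V. log 2 (card V) - log 2 (real (c v)))
      \<le> log 2 (card (linear_extensions V P)) + card V * (log 2 (exp 1) + log 2 (1 / d))"
    using greedy_entropy_le[OF assms(1,2) d(1,2) Cs] by blast
  have ne: "{} \<notin> set Cs" by (rule greedy_chain_nonempty[OF Cs partial_order_onD(1)[OF assms(2)]])
  have "real q \<le> (\<Sum>v\<in>V. log 2 (card V) - log 2 (real (c v))) + card V"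
    using c by (rule merge_run_chain_lists_cost[OF assms(1) partial_order_onD(3)[OF assms(2)] Cs ne run])
  moreover have "(\<Sum>v\<in>V. log 2 (card V) - log 2 (real (c v)))
      \<le> (1 + \<epsilon>) * (log 2 (card (linear_extensions V P)) + card V * (log 2 (exp 1) + log 2 (1 / d)))"
    using bound assms(5) unfolding d(3) by (simp add: field_simps)
  ultimately show ?thesis unfolding d(4) by (simp add: algebra_simps)
qed

end
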